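(* Let $X$ be a separable Banach space, $Y$ a Banach space, $G \subset X$ an open set, and $f: G \to Y$ an arbitrary mapping. Then there exists a $\sigma$-directionally porous set $A \subset G$ such that the following implication holds at each point $x \in G \setminus A$: if the one-sided Hadamard directional derivative $f'_{H+}(x,u)$ exists in all directions $u$ from some set $S_x \subset X$ whose linear span is dense in $X$, then $f$ is Hadamard differentiable at $x$.
   Context: All Banach spaces are real. $B(x,r)$ denotes the open ball with center $x$ and radius $r$. Directional porosity: a set $A \subset X$ is directionally porous at a point $x \in X$ if there exist $0 \neq v \in X$, $p>0$ and a sequence $t_n \to 0$ of positive real numbers such that $B(x+t_n v, p t_n) \cap A = \emptyset$ for every $n$. The set $A$ is directionally porous if it is directionally porous at each point $x \in A$, and $\sigma$-directionally porous if it is a countable union of directionally porous sets. One-sided Hadamard directional derivative of $f$ at $x \in G$ in the direction $v \in X$: $$f'_{H+}(x,v) := \lim_{z \to v,\ t \to 0+} \frac{f(x+tz)-f(x)}{t}$$ (limit in the norm of $Y$, over pairs $(z,t)$ with $z \in X$, $t>0$; $z=v$ is allowed). It exists if this limit exists in $Y$. Hadamard differentiability: $f$ is Hadamard differentiable at $x \in G$ if there is a continuous linear operator $L: X \to Y$ such that $\lim_{t \to 0} \frac{f(x+tv)-f(x)}{t} = L(v)$ for each $v \in X$, and the limit is uniform with respect to $v \in C$ whenever $C \subset X$ is a compact set. *)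

theory Defs
  imports "HOL-Analysis.Analysis"
begin

definition directionally_porous_at :: "'a::real_normed_vector set \<Rightarrow> 'a \<Rightarrow> bool" where
  "directionally_porous_at A x \<longleftrightarrow>
    (\<exists>v p. \<exists>t::nat \<Rightarrow> real. v \<noteq> 0 \<and> p > 0 \<and> (\<forall>n. t n > 0) \<and> t \<longlonglongrightarrow> 0 \<and>
      (\<forall>n. ball (x + t n *\<^sub>R v) (p * t n) \<inter> A = {}))"

definition directionally_porous :: "'a::real_normed_vector set \<Rightarrow> bool" where
  "directionally_porous A \<longleftrightarrow> (\<forall>x\<in>A. directionally_porous_at A x)"

definition sigma_directionally_porous :: "'a::real_normed_vector set \<Rightarrow> bool" where
  "sigma_directionally_porous A \<longleftrightarrow>
    (\<exists>\<C>. countable \<C> \<and> (\<forall>C\<in>\<C>. directionally_porous C) \<and> A = \<Union>\<C>)"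

(* A mapping f : G \<rightarrow> Y on an open set G is represented by a total function. The notions
   below are limits as the argument of f tends to x (locally uniformly in the direction), so
   for x in G they only depend on the values of f on G. *)

(* The filter in z is nhds v rather than at v, so z = v is allowed. *)
definition hadamard_right_derivative_exists ::
    "('a::real_normed_vector \<Rightarrow> 'b::real_normed_vector) \<Rightarrow> 'a \<Rightarrow> 'a \<Rightarrow> bool" where
  "hadamard_right_derivative_exists f x v \<longleftrightarrow>
    (\<exists>y. ((\<lambda>(z, t). (f (x + t *\<^sub>R z) - f x) /\<^sub>R t) \<longlongrightarrow> y) (nhds v \<times>\<^sub>F at_right (0::real)))"

definition hadamard_differentiable_at ::
    "('a::real_normed_vector \<Rightarrow> 'b::real_normed_vector) \<Rightarrow> 'a \<Rightarrow> bool" where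
  "hadamard_differentiable_at f x \<longleftrightarrow>
    (\<exists>L. bounded_linear L \<and>
      (\<forall>v. ((\<lambda>t::real. (f (x + t *\<^sub>R v) - f x) /\<^sub>R t) \<longlongrightarrow> L v) (at 0)) \<and>
      (\<forall>C. compact C \<longrightarrow>
        uniform_limit C (\<lambda>(t::real) v. (f (x + t *\<^sub>R v) - f x) /\<^sub>R t) L (at 0)))"

end

(* For e, d of the form 1/n and u in a countable dense set, let A(u,e,d) be the set of x at which
   t^-1 (f (x + t z) - f x) stays within e of some vector y_x for all z in ball u d, 0 < t < d.
   The exceptional set consists of the points at which one of these countably many sets is
   directionally porous and which belong to that set.  At any other point x, if the derivative in
   direction u exists, then for each w and all small t there is a point of the corresponding
   A(u,e,d) near x + t w, and y does not vary much between this point and x; so the increments of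
   f along u seen from x + t w are the ones seen from x.  Taking w = - u shows that f is pointwise
   Lipschitz at x, w = - 2 u gives the derivative in direction - u, arbitrary w gives additivity,
   and small w together with the Lipschitz bound shows that the set of directions of
   differentiability is closed. *)
theory Submission
  imports Defs
begin

section \<open>Difference quotients and right Hadamard limits\<close>

definition diff_quot :: "('a::real_normed_vector \<Rightarrow> 'b::real_normed_vector) \<Rightarrow> 'a \<Rightarrow> real \<Rightarrow> 'a \<Rightarrow> 'b" where
  "diff_quot f x t z = (f (x + t *\<^sub>R z) - f x) /\<^sub>R t"

text \<open>The product filter is unfolded into a ball for the direction and a filter in
  \<open>t\<close> alone, so that several such statements can be combined at a common small
  \<open>t\<close>.\<close>

definition hadamard_right_limit ::
    "('a::real_normed_vector \<Rightarrow> 'b::real_normed_vector) \<Rightarrow> 'a \<Rightarrow> 'a \<Rightarrow> 'b \<Rightarrow> bool" where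
  "hadamard_right_limit f x v y \<longleftrightarrow>
    (\<forall>e>0. \<exists>d>0. \<forall>\<^sub>F t in at_right 0. \<forall>z\<in>ball v d. norm (diff_quot f x t z - y) \<le> e)"

lemma hadamard_right_limitD:
  assumes "hadamard_right_limit f x v y" "e > 0"
  obtains d where "d > 0" "\<forall>\<^sub>F t in at_right 0. \<forall>z\<in>ball v d. norm (diff_quot f x t z - y) \<le> e"
  using assms unfolding hadamard_right_limit_def by blast

lemma diff_quot_0 [simp]: "diff_quot f x t 0 = 0"
  by (simp add: diff_quot_def)

lemma scaleR_diff_quot: "t \<noteq> 0 \<Longrightarrow> t *\<^sub>R diff_quot f x t z = f (x + t *\<^sub>R z) - f x"
  by (simp add: diff_quot_def)

lemma diff_quot_scaleR: "c \<noteq> 0 \<Longrightarrow> diff_quot f x t (c *\<^sub>R z) = c *\<^sub>R diff_quot f x (c * t) z"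
  by (simp add: diff_quot_def field_simps)

lemma hadamard_right_derivative_exists_imp_limit:
  assumes "hadamard_right_derivative_exists f x v"
  shows "\<exists>y. hadamard_right_limit f x v y"
proof -
  obtain y where y: "((\<lambda>(z, t). diff_quot f x t z) \<longlongrightarrow> y) (nhds v \<times>\<^sub>F at_right (0::real))"
    using assms unfolding hadamard_right_derivative_exists_def diff_quot_def by blast
  have "hadamard_right_limit f x v y"
    unfolding hadamard_right_limit_def
  proof (intro allI impI)
    fix e :: real assume "e > 0"
    then have "\<forall>\<^sub>F p in nhds v \<times>\<^sub>F at_right (0::real). dist ((\<lambda>(z, t). diff_quot f x t z) p) y < e"
      using y tendstoD by blast
    then obtain P Q where P: "eventually P (nhds v)" and Q: "eventually Q (at_right (0::real))"
      and PQ: "\<And>z t. P z \<Longrightarrow> Q t \<Longrightarrow> dist (diff_quot f x t z) y < e"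
      unfolding eventually_prod_filter by auto
    obtain d where d: "d > 0" "\<And>z. dist z v < d \<Longrightarrow> P z"
      using P unfolding eventually_nhds_metric by blast
    have "\<forall>\<^sub>F t in at_right 0. \<forall>z\<in>ball v d. norm (diff_quot f x t z - y) \<le> e"
      using Q by eventually_elim
        (metis PQ d(2) dist_commute dist_norm less_imp_le mem_ball)
    with d show "\<exists>d>0. \<forall>\<^sub>F t in at_right 0. \<forall>z\<in>ball v d. norm (diff_quot f x t z - y) \<le> e" by blast
  qed
  then show ?thesis ..
qed

section \<open>Approximate directional derivatives\<close>

definition approx_directional ::
    "('a::real_normed_vector \<Rightarrow> 'b::real_normed_vector) \<Rightarrow> 'a \<Rightarrow> real \<Rightarrow> real \<Rightarrow> 'a \<Rightarrow> 'b \<Rightarrow> bool" where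
  "approx_directional f u e d x y \<longleftrightarrow>
    (\<forall>t z. 0 < t \<and> t < d \<and> z \<in> ball u d \<longrightarrow> norm (f (x + t *\<^sub>R z) - f x - t *\<^sub>R y) \<le> e * t)"

lemma approx_directionalD:
  assumes "approx_directional f u e d x y" "0 < t" "t < d" "norm (z - u) < d"
  shows "norm (f (x + t *\<^sub>R z) - f x - t *\<^sub>R y) \<le> e * t"
  using assms unfolding approx_directional_def by (auto simp: dist_norm norm_minus_commute)

text \<open>Comparing the values at the two common points \<open>x + T u\<close> and \<open>x + 2 T u\<close> eliminates
  \<open>f x - f x'\<close>, about which nothing is known.\<close>

lemma approx_directional_close:
  assumes y: "approx_directional f u e d x y" and y': "approx_directional f u e d x' y'"
    and T: "T > 0" "2 * T < d" and x': "norm (x - x') < d * T"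
  shows "norm (y - y') \<le> 6 * e"
proof -
  have d: "d > 0" using T by simp
  \<comment> \<open>The directions \<open>z1\<close>, \<open>z2\<close> are those in which
    \<open>x'\<close> sees the points \<open>x + T u\<close> and \<open>x + 2 T u\<close>. Both lie
    within \<open>d\<close> of \<open>u\<close> because \<open>x'\<close> is closer to
    \<open>x\<close> than \<open>d * T\<close>.\<close>
  define z1 where "z1 = u + (1 / T) *\<^sub>R (x - x')"
  define z2 where "z2 = u + (1 / (2 * T)) *\<^sub>R (x - x')"
  have w1: "x' + T *\<^sub>R z1 = x + T *\<^sub>R u" and w2: "x' + (2 * T) *\<^sub>R z2 = x + (2 * T) *\<^sub>R u"
    using T by (simp_all add: z1_def z2_def scaleR_add_right)
  have "norm (x - x') / T < d" using x' T by (simp add: field_simps)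
  moreover have "norm (x - x') / (2 * T) \<le> norm (x - x') / T"
    using T by (intro divide_left_mono) auto
  ultimately have n: "norm (z1 - u) < d" "norm (z2 - u) < d"
    using T by (simp_all add: z1_def z2_def)
  let ?w1 = "f (x + T *\<^sub>R u)" and ?w2 = "f (x + (2 * T) *\<^sub>R u)"
  define a1 where "a1 = ?w1 - f x - T *\<^sub>R y"
  define a2 where "a2 = ?w2 - f x - (2 * T) *\<^sub>R y"
  define b1 where "b1 = ?w1 - f x' - T *\<^sub>R y'"
  define b2 where "b2 = ?w2 - f x' - (2 * T) *\<^sub>R y'"
  have "norm a1 \<le> e * T" "norm a2 \<le> e * (2 * T)"
    unfolding a1_def a2_def by (intro approx_directionalD[OF y]; use T d in simp)+
  moreover have "norm b1 \<le> e * T" "norm b2 \<le> e * (2 * T)"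
    unfolding b1_def b2_def
    using approx_directionalD[OF y', of T z1] approx_directionalD[OF y', of "2 * T" z2] T n w1 w2
    by simp_all
  moreover have two: "(2 * T) *\<^sub>R v = T *\<^sub>R v + T *\<^sub>R v" for v :: 'b
    by (simp only: mult_2 scaleR_add_left)
  \<comment> \<open>In \<open>a1 - a2\<close> the value \<open>f x\<close> cancels, in
    \<open>b1 - b2\<close> the value \<open>f x'\<close>, and the values at the two common points
    cancel between them. The errors add up to \<open>(1 + 2 + 1 + 2) * e * T\<close>, hence the
    constant 6.\<close>
  have eq: "T *\<^sub>R (y - y') = (a1 - a2) - (b1 - b2)"
    unfolding a1_def a2_def b1_def b2_def two by (simp add: algebra_simps)
  ultimately have "norm (T *\<^sub>R (y - y')) \<le> 6 * e * T"
    unfolding eq using norm_triangle_ineq4[of "a1 - a2" "b1 - b2"] norm_triangle_ineq4[of a1 a2]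
      norm_triangle_ineq4[of b1 b2] by linarith
  then show ?thesis using T by simp
qed

section \<open>Non-porosity and steadiness of increments\<close>

lemma not_directionally_porous_atD:
  assumes "\<not> directionally_porous_at A x" "v \<noteq> 0" "p > 0"
  shows "\<forall>\<^sub>F t in at_right 0. ball (x + t *\<^sub>R v) (p * t) \<inter> A \<noteq> {}"
proof (rule ccontr)
  assume "\<not> ?thesis"
  \<comment> \<open>Holes at arbitrarily small scales yield one below each
    \<open>1 / (n + 1)\<close>, and these scales form a sequence witnessing porosity.\<close>
  then have "\<exists>t. 0 < t \<and> t < inverse (real (Suc n)) \<and> ball (x + t *\<^sub>R v) (p * t) \<inter> A = {}" for n
    unfolding eventually_at_right_field
    by (metis inverse_positive_iff_positive of_nat_0_less_iff zero_less_Suc)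
  then obtain t where t: "\<And>n. 0 < t n" "\<And>n. t n < inverse (real (Suc n))"
      "\<And>n. ball (x + t n *\<^sub>R v) (p * t n) \<inter> A = {}"
    by metis
  have "t \<longlonglongrightarrow> 0"
    by (rule tendsto_sandwich[OF _ _ tendsto_const LIMSEQ_inverse_real_of_nat])
      (auto simp del: of_nat_Suc intro!: always_eventually less_imp_le t)
  with t assms show False unfolding directionally_porous_at_def by blast
qed

lemma directionally_porous_at_mono:
  "directionally_porous_at A x \<Longrightarrow> B \<subseteq> A \<Longrightarrow> directionally_porous_at B x"
  unfolding directionally_porous_at_def by (metis Int_mono bot.extremum_uniqueI subset_refl)

definition approx_set ::
    "('a::real_normed_vector \<Rightarrow> 'b::real_normed_vector) \<Rightarrow> 'a \<Rightarrow> nat \<Rightarrow> nat \<Rightarrow> 'a set" where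
  "approx_set f u m n = {x. \<exists>y. approx_directional f u (inverse (Suc m)) (inverse (Suc n)) x y}"

text \<open>The point \<open>c\<close> depends on \<open>t\<close>, but neither on \<open>s\<close> nor on \<open>z\<close>.\<close>

definition hadamard_steady ::
    "('a::real_normed_vector \<Rightarrow> 'b::real_normed_vector) \<Rightarrow> 'a \<Rightarrow> bool" where
  "hadamard_steady f x \<longleftrightarrow>
    (\<forall>u y w. \<forall>e>0. hadamard_right_limit f x u y \<longrightarrow>
      (\<exists>p>0. p \<le> e \<and> (\<forall>\<^sub>F t in at_right 0. \<exists>c\<in>ball w p. \<forall>s\<in>{0..2}. \<forall>z\<in>ball u (2 * p).
        norm (diff_quot f x t (c + s *\<^sub>R z) - diff_quot f x t c - s *\<^sub>R y) \<le> e)))"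

text \<open>In the difference of the two quotients \<open>f x\<close> cancels, leaving the increment
  of \<open>f\<close> from \<open>x + t c\<close> over the step \<open>t * s\<close>, divided by
  \<open>t\<close>. The approximation at \<open>x + t c\<close> costs \<open>e * s\<close>,
  replacing \<open>y'\<close> by \<open>y\<close> costs \<open>6 * e * s\<close>, and s \<le> 2
  gives the constant 14.\<close>

lemma approx_directional_diff_quot:
  assumes A: "approx_directional f u e d (x + t *\<^sub>R c) y'" and "norm (y - y') \<le> 6 * e"
    and t: "0 < t" "2 * t < d" and s: "s \<in> {0..2}" and z: "z \<in> ball u d" and "e \<ge> 0"
  shows "norm (diff_quot f x t (c + s *\<^sub>R z) - diff_quot f x t c - s *\<^sub>R y) \<le> 14 * e"
proof (cases "s = 0")
  case False
  with s have s: "0 < s" "s \<le> 2" by auto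
  have "t * s \<le> t * 2" using t s by simp
  then have ts: "t * s < d" using t by linarith
  have "norm (f (x + t *\<^sub>R c + (t * s) *\<^sub>R z) - f (x + t *\<^sub>R c) - (t * s) *\<^sub>R y') \<le> e * (t * s)"
    using t s z ts by (intro approx_directionalD[OF A]) (auto simp: dist_norm norm_minus_commute)
  moreover have "f (x + t *\<^sub>R c + (t * s) *\<^sub>R z) - f (x + t *\<^sub>R c) - (t * s) *\<^sub>R y'
      = t *\<^sub>R (diff_quot f x t (c + s *\<^sub>R z) - diff_quot f x t c - s *\<^sub>R y')"
  proof -
    have "t *\<^sub>R diff_quot f x t (c + s *\<^sub>R z) = f (x + t *\<^sub>R c + (t * s) *\<^sub>R z) - f x"
      using t by (simp add: scaleR_diff_quot scaleR_add_right add.assoc)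
    moreover have "t *\<^sub>R diff_quot f x t c = f (x + t *\<^sub>R c) - f x"
      using t by (simp add: scaleR_diff_quot)
    ultimately show ?thesis by (simp add: scaleR_diff_right)
  qed
  ultimately have 1: "norm (diff_quot f x t (c + s *\<^sub>R z) - diff_quot f x t c - s *\<^sub>R y') \<le> e * s"
    using t by simp
  have "norm (s *\<^sub>R (y - y')) \<le> s * (6 * e)"
    using s assms by simp
  with 1 have "norm ((diff_quot f x t (c + s *\<^sub>R z) - diff_quot f x t c - s *\<^sub>R y') - s *\<^sub>R (y - y'))
      \<le> e * s + s * (6 * e)"
    by (rule order_trans[OF norm_triangle_ineq4 add_mono])
  moreover have "diff_quot f x t (c + s *\<^sub>R z) - diff_quot f x t c - s *\<^sub>R y
      = (diff_quot f x t (c + s *\<^sub>R z) - diff_quot f x t c - s *\<^sub>R y') - s *\<^sub>R (y - y')"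
    by (simp add: scaleR_diff_right)
  ultimately have "norm (diff_quot f x t (c + s *\<^sub>R z) - diff_quot f x t c - s *\<^sub>R y) \<le> e * s + s * (6 * e)"
    by (simp only:)
  also have "\<dots> = 7 * (e * s)" by simp
  also have "e * s \<le> e * 2" using s \<open>e \<ge> 0\<close> by (intro mult_left_mono) auto
  finally show ?thesis by simp
qed (use assms in simp)

text \<open>Non-porosity supplies, for each small \<open>t\<close>, a point \<open>x + t c\<close>
  of the same approximation set with \<open>c\<close> near \<open>w\<close>. Its own approximate
  derivative \<open>y'\<close> is close to \<open>y\<close> by
  \<open>approx_directional_close\<close>, so increments along \<open>u\<close> seen from there are
  nearly \<open>s y\<close>.\<close>

lemma hadamard_steadyI:
  fixes f :: "'a::real_normed_vector \<Rightarrow> 'b::real_normed_vector"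
  assumes D: "closure D = UNIV"
    and np: "\<And>u m n. u \<in> D \<Longrightarrow> x \<in> approx_set f u m n \<Longrightarrow> \<not> directionally_porous_at (approx_set f u m n) x"
  shows "hadamard_steady f x"
  unfolding hadamard_steady_def
proof (intro allI impI)
  fix u y w and e :: real
  assume "e > 0" and lim: "hadamard_right_limit f x u y"
  obtain m where m: "14 * inverse (real (Suc m)) < e"
    using reals_Archimedean[of "e / 14"] \<open>e > 0\<close> by (auto simp: field_simps)
  obtain d1 where d1: "d1 > 0"
      "\<forall>\<^sub>F t in at_right 0. \<forall>z\<in>ball u d1. norm (diff_quot f x t z - y) \<le> inverse (Suc m)"
    using hadamard_right_limitD[OF lim, of "inverse (Suc m)"] by auto
  then obtain d2 where d2: "d2 > 0"
      "\<And>t z. 0 < t \<Longrightarrow> t < d2 \<Longrightarrow> z \<in> ball u d1 \<Longrightarrow> norm (diff_quot f x t z - y) \<le> inverse (Suc m)"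
    unfolding eventually_at_right_field by blast
  define d0 where "d0 = min d1 d2"
  have d0: "d0 > 0"
      "\<And>t z. 0 < t \<Longrightarrow> t < d0 \<Longrightarrow> z \<in> ball u d0 \<Longrightarrow> norm (diff_quot f x t z - y) \<le> inverse (Suc m)"
    using d1 d2 by (auto simp: d0_def)
  obtain n where n: "inverse (real (Suc n)) < d0 / 2"
    using reals_Archimedean[of "d0 / 2"] d0 by auto
  define d where "d = inverse (real (Suc n))"
  define r where "r = inverse (real (Suc m))"
  have d: "0 < d" "2 * d < d0" and r: "0 < r" "14 * r < e" using n m by (auto simp: d_def r_def)
  have "u \<in> closure D" using D by simp
  then obtain u' where u': "u' \<in> D" "dist u' u < d / 2"
    using d by (metis closure_approachable half_gt_zero)
  \<comment> \<open>The direction \<open>u\<close> is replaced by \<open>u'\<close> from the dense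
    set while \<open>y\<close> is kept: for \<open>z\<close> in \<open>ball u' d\<close>, the
    distance to \<open>u\<close> is below \<open>d / 2 + d\<close>, hence below
    \<open>d0\<close>.\<close>
  have xy: "approx_directional f u' r d x y"
    unfolding approx_directional_def
  proof (intro allI impI)
    fix t z assume tz: "0 < t \<and> t < d \<and> z \<in> ball u' d"
    have "dist u z \<le> dist u' u + dist u' z" by (metis dist_commute dist_triangle)
    then have "norm (diff_quot f x t z - y) \<le> r"
      unfolding r_def using tz d u' by (intro d0) auto
    then have "norm (t *\<^sub>R (diff_quot f x t z - y)) \<le> r * t" using tz by simp
    then show "norm (f (x + t *\<^sub>R z) - f x - t *\<^sub>R y) \<le> r * t"
      using tz by (simp add: scaleR_diff_right scaleR_diff_quot)
  qed
  define M where "M = approx_set f u' m n"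
  have M: "M = {x. \<exists>y. approx_directional f u' r d x y}"
    by (simp add: M_def approx_set_def r_def d_def)
  have nM: "\<not> directionally_porous_at M x"
    using np[OF u'(1), of m n] xy M unfolding M_def by blast
  \<comment> \<open>With this bound, \<open>ball u (2 * p)\<close> lies in \<open>ball u' d\<close>,
    as \<open>d / 2 + 2 * p\<close> is less than \<open>d\<close>.\<close>
  define p where "p = min e (d / 8)"
  have p: "p > 0" "p \<le> e" "8 * p \<le> d" using \<open>e > 0\<close> d by (auto simp: p_def)
  \<comment> \<open>Porosity concerns nonzero directions only, so w = 0 is separate: there c = 0
    works because \<open>x\<close> itself is in \<open>M\<close>.\<close>
  have t0: "\<forall>\<^sub>F t in at_right 0. \<exists>c\<in>ball w p. x + t *\<^sub>R c \<in> M"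
  proof (cases "w = 0")
    case True
    then show ?thesis using p xy M by (intro always_eventually allI bexI[of _ 0]) auto
  next
    case False
    show ?thesis
      using not_directionally_porous_atD[OF nM False \<open>p > 0\<close>] eventually_at_right_less[of 0]
    proof eventually_elim
      case (elim t)
      then obtain x' where x': "x' \<in> M" "dist (x + t *\<^sub>R w) x' < p * t" by auto
      define c where "c = (x' - x) /\<^sub>R t"
      have c: "x' = x + t *\<^sub>R c" using elim by (simp add: c_def)
      then have "norm (t *\<^sub>R (w - c)) < p * t" using x'(2) by (simp add: dist_norm scaleR_diff_right)
      then have "c \<in> ball w p" using elim by (simp add: dist_norm)
      with c x' show ?case by blast
    qed
  qed
  \<comment> \<open>The point \<open>x + t c\<close> is at distance below
    \<open>t * (norm w + p) = d * (t * k)\<close> from \<open>x\<close>. This is the closeness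
    required by \<open>approx_directional_close\<close> at scale T = t * k, and the bound
    \<open>d / (2 * k)\<close> on \<open>t\<close> below makes that scale admissible.\<close>
  define k where "k = (norm w + p) / d"
  have k: "k > 0" using p d by (auto simp: k_def intro!: divide_pos_pos add_nonneg_pos)
  have small: "\<forall>\<^sub>F t in at_right 0. t < min (d / 2) (d / (2 * k))"
    using d k by (intro order_tendstoD(2)[OF tendsto_ident_at]) simp
  have "\<forall>\<^sub>F t in at_right 0. \<exists>c\<in>ball w p. \<forall>s\<in>{0..2}. \<forall>z\<in>ball u (2 * p).
        norm (diff_quot f x t (c + s *\<^sub>R z) - diff_quot f x t c - s *\<^sub>R y) \<le> e"
    using t0 small eventually_at_right_less[of 0]
  proof eventually_elim
    case (elim t)
    then have t: "0 < t" "2 * t < d" "2 * (t * k) < d"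
      using k by (auto simp: field_simps)
    obtain c y' where c: "c \<in> ball w p" and y': "approx_directional f u' r d (x + t *\<^sub>R c) y'"
      using elim M by auto
    have "norm c < norm w + p" using c norm_triangle_ineq2[of c w]
      by (simp add: dist_norm norm_minus_commute)
    then have "norm (x - (x + t *\<^sub>R c)) < d * (t * k)"
      using t d by (simp add: k_def)
    then have yy: "norm (y - y') \<le> 6 * r"
      using t k by (intro approx_directional_close[OF xy y', of "t * k"]) auto
    show "\<exists>c\<in>ball w p. \<forall>s\<in>{0..2}. \<forall>z\<in>ball u (2 * p).
        norm (diff_quot f x t (c + s *\<^sub>R z) - diff_quot f x t c - s *\<^sub>R y) \<le> e"
    proof (intro bexI[OF _ c] ballI)
      fix s :: real and z assume s: "s \<in> {0..2}" and z: "z \<in> ball u (2 * p)"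
      have "dist u' z \<le> dist u' u + dist u z" by (rule dist_triangle)
      then have "z \<in> ball u' d" using z u' p by auto
      then have "norm (diff_quot f x t (c + s *\<^sub>R z) - diff_quot f x t c - s *\<^sub>R y) \<le> 14 * r"
        using t s r by (intro approx_directional_diff_quot[OF y' yy]) auto
      then show "norm (diff_quot f x t (c + s *\<^sub>R z) - diff_quot f x t c - s *\<^sub>R y) \<le> e"
        using r by linarith
    qed
  qed
  with p show "\<exists>p>0. p \<le> e \<and> (\<forall>\<^sub>F t in at_right 0. \<exists>c\<in>ball w p. \<forall>s\<in>{0..2}. \<forall>z\<in>ball u (2 * p).
        norm (diff_quot f x t (c + s *\<^sub>R z) - diff_quot f x t c - s *\<^sub>R y) \<le> e)" by blast
qed

section \<open>Algebra of right Hadamard limits\<close>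

lemma hadamard_steadyD:
  assumes "hadamard_steady f x" "hadamard_right_limit f x u y" "e > 0"
  obtains p where "p > 0" "p \<le> e"
    "\<forall>\<^sub>F t in at_right 0. \<exists>c\<in>ball w p. \<forall>s\<in>{0..2}. \<forall>z\<in>ball u (2 * p).
        norm (diff_quot f x t (c + s *\<^sub>R z) - diff_quot f x t c - s *\<^sub>R y) \<le> e"
  using assms unfolding hadamard_steady_def by blast

text \<open>The case s = 1, with the ball recentred from \<open>c + u\<close> to
  \<open>w + u\<close>. Since \<open>c\<close> is within \<open>p\<close> of \<open>w\<close>, this
  uses up half of the radius \<open>2 * p\<close> allowed around \<open>u\<close>.\<close>

lemma hadamard_steady_translate:
  assumes "hadamard_steady f x" "hadamard_right_limit f x u y" "e > 0"
  obtains p where "p > 0" "p \<le> e"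
    "\<forall>\<^sub>F t in at_right 0. \<exists>c\<in>ball w p. \<forall>z\<in>ball (w + u) p.
        norm (diff_quot f x t z - diff_quot f x t c - y) \<le> e"
proof -
  obtain p where p: "p > 0" "p \<le> e" and *:
    "\<forall>\<^sub>F t in at_right 0. \<exists>c\<in>ball w p. \<forall>s\<in>{0..2}. \<forall>z\<in>ball u (2 * p).
        norm (diff_quot f x t (c + s *\<^sub>R z) - diff_quot f x t c - s *\<^sub>R y) \<le> e"
    using hadamard_steadyD[OF assms, of w] .
  have "\<forall>\<^sub>F t in at_right 0. \<exists>c\<in>ball w p. \<forall>z\<in>ball (w + u) p.
        norm (diff_quot f x t z - diff_quot f x t c - y) \<le> e"
    using *
  proof eventually_elim
    case (elim t)
    obtain c where c: "c \<in> ball w p" and *: "\<forall>s\<in>{0..2}. \<forall>z\<in>ball u (2 * p).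
        norm (diff_quot f x t (c + s *\<^sub>R z) - diff_quot f x t c - s *\<^sub>R y) \<le> e"
      using elim by (rule bexE)
    have "norm (diff_quot f x t z - diff_quot f x t c - y) \<le> e" if "z \<in> ball (w + u) p" for z
    proof -
      have "dist u (z - c) < 2 * p" using that c unfolding mem_ball by norm
      then show ?thesis using *[rule_format, of 1 "z - c"] by simp
    qed
    with c show ?case by blast
  qed
  with p that show thesis by blast
qed

lemma hadamard_right_limit_unique:
  assumes "hadamard_right_limit f x v y" "hadamard_right_limit f x v y'"
  shows "y = y'"
proof -
  have "norm (y - y') \<le> 0"
  proof (rule field_le_epsilon)
    fix e :: real assume "e > 0"
    then have e: "e / 2 > 0" by simp
    obtain d where d: "d > 0" "\<forall>\<^sub>F t in at_right 0. \<forall>z\<in>ball v d. norm (diff_quot f x t z - y) \<le> e / 2"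
      using hadamard_right_limitD[OF assms(1) e] .
    obtain d' where d': "d' > 0" "\<forall>\<^sub>F t in at_right 0. \<forall>z\<in>ball v d'. norm (diff_quot f x t z - y') \<le> e / 2"
      using hadamard_right_limitD[OF assms(2) e] .
    have "\<forall>\<^sub>F t in at_right (0::real). norm (y - y') \<le> 0 + e"
      using d(2) d'(2)
    proof eventually_elim
      case (elim t)
      then have "norm (diff_quot f x t v - y) \<le> e / 2" "norm (diff_quot f x t v - y') \<le> e / 2"
        using d d' by auto
      then show ?case by norm
    qed
    then show "norm (y - y') \<le> 0 + e" by simp
  qed
  then show ?thesis by simp
qed

text \<open>Passing from \<open>t\<close> to \<open>c * t\<close> preserves
  \<open>at_right 0\<close> for positive \<open>c\<close>; a negative factor would reverse the side
  and is treated through \<open>hadamard_steady_limit_minus\<close>.\<close>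

lemma hadamard_right_limit_scaleR:
  assumes "hadamard_right_limit f x v y" "c > 0"
  shows "hadamard_right_limit f x (c *\<^sub>R v) (c *\<^sub>R y)"
  unfolding hadamard_right_limit_def
proof (intro allI impI)
  fix e :: real assume "e > 0"
  with assms have e: "e / c > 0" by simp
  obtain d where d: "d > 0"
      "\<forall>\<^sub>F t in at_right 0. \<forall>z\<in>ball v d. norm (diff_quot f x t z - y) \<le> e / c"
    using hadamard_right_limitD[OF assms(1) e] .
  have "filtermap ((*) c) (at_right 0) = at_right 0"
    using filtermap_times_pos_at_right[of c 0] assms by simp
  then have "\<forall>\<^sub>F t in filtermap ((*) c) (at_right 0). \<forall>z\<in>ball v d. norm (diff_quot f x t z - y) \<le> e / c"
    using d(2) by (simp only:)
  then have "\<forall>\<^sub>F t in at_right 0. \<forall>z\<in>ball v d. norm (diff_quot f x (c * t) z - y) \<le> e / c"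
    by (simp only: eventually_filtermap)
  then have "\<forall>\<^sub>F t in at_right 0. \<forall>z\<in>ball (c *\<^sub>R v) (d * c). norm (diff_quot f x t z - c *\<^sub>R y) \<le> e"
  proof eventually_elim
    case (elim t)
    show ?case
    proof
      fix z assume z0: "z \<in> ball (c *\<^sub>R v) (d * c)"
      define z' where "z' = z /\<^sub>R c"
      have z: "z = c *\<^sub>R z'" using assms by (simp add: z'_def)
      have "norm (c *\<^sub>R (v - z')) < d * c" using z0 by (simp add: z dist_norm scaleR_diff_right)
      then have "norm (diff_quot f x (c * t) z' - y) \<le> e / c"
        using assms elim by (simp add: dist_norm)
      then have "norm (c *\<^sub>R (diff_quot f x (c * t) z' - y)) \<le> e"
        using assms by (simp add: pos_le_divide_eq mult.commute del: scaleR_diff_right)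
      then show "norm (diff_quot f x t z - c *\<^sub>R y) \<le> e"
        using assms by (simp add: z diff_quot_scaleR scaleR_diff_right mult.commute del: norm_scaleR)
    qed
  qed
  with d assms show "\<exists>d>0. \<forall>\<^sub>F t in at_right 0. \<forall>z\<in>ball (c *\<^sub>R v) d. norm (diff_quot f x t z - c *\<^sub>R y) \<le> e"
    by (intro exI[of _ "d * c"]) simp
qed

text \<open>With w = - u, the quotients at \<open>z\<close> near 0 and at 0 itself are both within
  \<open>e / 2\<close> of the same vector \<open>diff_quot f x t c + y\<close>, and the one at 0
  vanishes.\<close>

lemma hadamard_steady_limit_0:
  assumes "hadamard_steady f x" "hadamard_right_limit f x u y"
  shows "hadamard_right_limit f x 0 0"
  unfolding hadamard_right_limit_def
proof (intro allI impI)
  fix e :: real assume "e > 0"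
  then have e: "e / 2 > 0" by simp
  obtain p where p: "p > 0" and *: "\<forall>\<^sub>F t in at_right 0. \<exists>c\<in>ball (- u) p. \<forall>z\<in>ball (- u + u) p.
        norm (diff_quot f x t z - diff_quot f x t c - y) \<le> e / 2"
    using hadamard_steady_translate[OF assms e] .
  have "\<forall>\<^sub>F t in at_right 0. \<forall>z\<in>ball 0 p. norm (diff_quot f x t z - 0) \<le> e"
    using *
  proof eventually_elim
    case (elim t)
    then obtain c where c: "\<And>z. z \<in> ball 0 p \<Longrightarrow> norm (diff_quot f x t z - diff_quot f x t c - y) \<le> e / 2"
      unfolding left_minus by blast
    have "norm (diff_quot f x t z - 0) \<le> e" if "z \<in> ball 0 p" for z
      using c[OF that] c[of 0] p by simp norm
    then show ?case by blast
  qed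
  with p show "\<exists>d>0. \<forall>\<^sub>F t in at_right 0. \<forall>z\<in>ball 0 d. norm (diff_quot f x t z - 0) \<le> e" by blast
qed

text \<open>Go from \<open>x\<close> to \<open>x + t c\<close> with \<open>c\<close> near
  \<open>w\<close>, then along \<open>u\<close>. The first leg has quotient near \<open>y'\<close>
  because \<open>p\<close> is at most \<open>d\<close>, so that the limit along \<open>w\<close>
  covers \<open>c\<close> although \<open>c\<close> varies with \<open>t\<close>; steadiness makes
  the second leg contribute nearly \<open>y\<close>.\<close>

lemma hadamard_steady_limit_add:
  assumes "hadamard_steady f x" "hadamard_right_limit f x u y" "hadamard_right_limit f x w y'"
  shows "hadamard_right_limit f x (w + u) (y' + y)"
  unfolding hadamard_right_limit_def
proof (intro allI impI)
  fix e :: real assume "e > 0"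
  then have e: "e / 2 > 0" by simp
  obtain d where d: "d > 0" "\<forall>\<^sub>F t in at_right 0. \<forall>z\<in>ball w d. norm (diff_quot f x t z - y') \<le> e / 2"
    using hadamard_right_limitD[OF assms(3) e] .
  have e': "min d (e / 2) > 0" using d \<open>e > 0\<close> by simp
  obtain p where p: "p > 0" "p \<le> min d (e / 2)" and *: "\<forall>\<^sub>F t in at_right 0. \<exists>c\<in>ball w p. \<forall>z\<in>ball (w + u) p.
        norm (diff_quot f x t z - diff_quot f x t c - y) \<le> min d (e / 2)"
    using hadamard_steady_translate[OF assms(1,2) e'] .
  have "\<forall>\<^sub>F t in at_right 0. \<forall>z\<in>ball (w + u) p. norm (diff_quot f x t z - (y' + y)) \<le> e"
    using * d(2)
  proof eventually_elim
    case (elim t)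
    then obtain c where c: "c \<in> ball w p" "\<And>z. z \<in> ball (w + u) p \<Longrightarrow> norm (diff_quot f x t z - diff_quot f x t c - y) \<le> e / 2"
      by auto
    then have *: "norm (diff_quot f x t c - y') \<le> e / 2" using elim p by auto
    show ?case
    proof
      fix z assume "z \<in> ball (w + u) p"
      then have "norm (diff_quot f x t z - diff_quot f x t c - y) \<le> e / 2" by (rule c(2))
      with * show "norm (diff_quot f x t z - (y' + y)) \<le> e" by norm
    qed
  qed
  with p show "\<exists>d>0. \<forall>\<^sub>F t in at_right 0. \<forall>z\<in>ball (w + u) d. norm (diff_quot f x t z - (y' + y)) \<le> e" by blast
qed

text \<open>Both \<open>0\<close> and the points near \<open>- u\<close> are reached from the same point near \<open>- 2 u\<close>.\<close>

lemma hadamard_steady_limit_minus: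
  assumes "hadamard_steady f x" "hadamard_right_limit f x u y"
  shows "hadamard_right_limit f x (- u) (- y)"
  unfolding hadamard_right_limit_def
proof (intro allI impI)
  fix e :: real assume "e > 0"
  then have e: "e / 2 > 0" by simp
  obtain p where p: "p > 0" and *: "\<forall>\<^sub>F t in at_right 0. \<exists>c\<in>ball (- 2 *\<^sub>R u) p. \<forall>s\<in>{0..2}. \<forall>z\<in>ball u (2 * p).
        norm (diff_quot f x t (c + s *\<^sub>R z) - diff_quot f x t c - s *\<^sub>R y) \<le> e / 2"
    using hadamard_steadyD[OF assms e] .
  have "\<forall>\<^sub>F t in at_right 0. \<forall>z\<in>ball (- u) p. norm (diff_quot f x t z - - y) \<le> e"
    using *
  proof eventually_elim
    case (elim t)
    then obtain c where c: "norm (- 2 *\<^sub>R u - c) < p" and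
      *: "\<And>s z. s \<in> {0..2} \<Longrightarrow> norm (u - z) < 2 * p \<Longrightarrow>
        norm (diff_quot f x t (c + s *\<^sub>R z) - diff_quot f x t c - s *\<^sub>R y) \<le> e / 2"
      by (auto simp: dist_norm)
    \<comment> \<open>The choice s = 2, z = - c / 2 makes \<open>c + s z\<close> exactly 0, where
      the quotient vanishes; this \<open>z\<close> is near \<open>u\<close> because \<open>c\<close>
      is near \<open>- 2 u\<close>. So the quotient at \<open>c\<close> is nearly
      \<open>- 2 y\<close>, and s = 1 then adds \<open>y\<close>.\<close>
    have "u - (- (1/2)) *\<^sub>R c = (- (1/2)) *\<^sub>R (- 2 *\<^sub>R u - c)"
      by (simp add: scaleR_diff_right)
    then have "norm (u - (- (1/2)) *\<^sub>R c) = norm (- 2 *\<^sub>R u - c) / 2"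
      by simp
    then have "norm (diff_quot f x t (c + 2 *\<^sub>R (- (1/2)) *\<^sub>R c) - diff_quot f x t c - 2 *\<^sub>R y) \<le> e / 2"
      using c p by (intro *) auto
    then have 0: "norm (0 - diff_quot f x t c - 2 *\<^sub>R y) \<le> e / 2" by simp
    show ?case
    proof
      fix z assume z: "z \<in> ball (- u) p"
      have "norm (u - (z - c)) < 2 * p" using z c unfolding mem_ball by norm
      then have "norm (diff_quot f x t z - diff_quot f x t c - y) \<le> e / 2"
        using *[of 1 "z - c"] by simp
      with 0 show "norm (diff_quot f x t z - - y) \<le> e" by norm
    qed
  qed
  with p show "\<exists>d>0. \<forall>\<^sub>F t in at_right 0. \<forall>z\<in>ball (- u) d. norm (diff_quot f x t z - - y) \<le> e" by blast
qed

section \<open>Lipschitz bound, completeness and closedness\<close>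

text \<open>The quotients are at most 1 on a ball of radius \<open>d\<close> for small
  \<open>t\<close>. Rescaling \<open>z\<close> to norm \<open>d / 2\<close> and \<open>t\<close> by
  the inverse factor extends this with constant \<open>2 / d\<close>; the radius \<open>R\<close>
  affects only how small \<open>t\<close> must be.\<close>

lemma hadamard_right_limit_0_bound:
  assumes "hadamard_right_limit f x 0 0"
  obtains K where "K > 0" "\<And>R. \<forall>\<^sub>F t in at_right 0. \<forall>z\<in>ball 0 R. norm (diff_quot f x t z) \<le> K * norm z"
proof -
  obtain d where d: "d > 0" and *: "\<forall>\<^sub>F t in at_right 0. \<forall>z\<in>ball 0 d. norm (diff_quot f x t z) \<le> 1"
    using hadamard_right_limitD[OF assms, of 1] by auto
  obtain b where b: "b > 0" "\<And>t z. 0 < t \<Longrightarrow> t < b \<Longrightarrow> z \<in> ball 0 d \<Longrightarrow> norm (diff_quot f x t z) \<le> 1"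
    using * unfolding eventually_at_right_field by blast
  have "\<forall>\<^sub>F t in at_right 0. \<forall>z\<in>ball 0 R. norm (diff_quot f x t z) \<le> 2 / d * norm z" for R
  proof (cases "R > 0")
    case True
    have "\<forall>\<^sub>F t in at_right 0. t < b * d / (2 * R)"
      using b d True by (intro order_tendstoD(2)[OF tendsto_ident_at]) simp
    then show ?thesis using eventually_at_right_less[of 0]
    proof eventually_elim
      case (elim t)
      show ?case
      proof
        fix z :: 'a assume z: "z \<in> ball 0 R"
        show "norm (diff_quot f x t z) \<le> 2 / d * norm z"
        proof (cases "z = 0")
          case False
          define c where "c = 2 / d * norm z"
          have c: "c > 0" using False d by (simp add: c_def)
          define z' where "z' = z /\<^sub>R c"
          have z': "z = c *\<^sub>R z'" using c by (simp add: z'_def)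
          have "norm z' = d / 2" using False d c by (simp add: z'_def c_def)
          moreover have "c * t < b"
          proof -
            have "t * norm z \<le> t * R" using z elim by (intro mult_left_mono) auto
            also have "\<dots> < b * d / 2" using elim True by (simp add: field_simps)
            finally show ?thesis using d by (simp add: c_def field_simps)
          qed
          ultimately have "norm (diff_quot f x (c * t) z') \<le> 1"
            using elim c d by (intro b(2)) auto
          then have "norm (diff_quot f x t z) \<le> c"
            using c by (simp add: z' diff_quot_scaleR)
          then show ?thesis by (simp add: c_def)
        qed simp
      qed
    qed
  qed (simp add: ball_empty)
  then show thesis using that[of "2 / d"] d by simp
qed

text \<open>The approximating vector may depend on \<open>e\<close>: vectors for two accuracies are
  both close to the quotient at \<open>v\<close> for a common small \<open>t\<close>, so they form a
  Cauchy sequence, and completeness of the target gives the limit.\<close>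

lemma hadamard_right_limit_cauchy:
  fixes f :: "'a::real_normed_vector \<Rightarrow> 'b::banach"
  assumes "\<And>e. e > 0 \<Longrightarrow>
    \<exists>y. \<exists>d>0. \<forall>\<^sub>F t in at_right 0. \<forall>z\<in>ball v d. norm (diff_quot f x t z - y) \<le> e"
  shows "\<exists>y. hadamard_right_limit f x v y"
proof -
  have "\<exists>y. \<exists>d>0. \<forall>\<^sub>F t in at_right 0. \<forall>z\<in>ball v d. norm (diff_quot f x t z - y) \<le> inverse (Suc n)" for n
    by (intro assms) simp
  from choice[OF allI, OF this] obtain Y where
    Y: "\<forall>n. \<exists>d>0. \<forall>\<^sub>F t in at_right 0. \<forall>z\<in>ball v d. norm (diff_quot f x t z - Y n) \<le> inverse (Suc n)"
    by (rule exE)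
  have dist: "dist (Y m) (Y n) \<le> inverse (Suc m) + inverse (Suc n)" for m n
  proof -
    have "\<forall>\<^sub>F t in at_right 0. norm (diff_quot f x t v - Y k) \<le> inverse (Suc k)" for k
      using Y[rule_format, of k] by (auto elim!: eventually_mono)
    then have "\<forall>\<^sub>F t in at_right 0. norm (diff_quot f x t v - Y m) \<le> inverse (Suc m) \<and>
        norm (diff_quot f x t v - Y n) \<le> inverse (Suc n)"
      by (intro eventually_conj)
    then have "\<forall>\<^sub>F t in at_right (0::real). dist (Y m) (Y n) \<le> inverse (Suc m) + inverse (Suc n)"
      by eventually_elim norm
    then show ?thesis by simp
  qed
  have "Cauchy Y"
    unfolding Cauchy_def
  proof (intro allI impI)
    fix e :: real assume "e > 0"
    then obtain M where M: "inverse (real (Suc M)) < e / 2" using reals_Archimedean[of "e / 2"] by auto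
    have "dist (Y m) (Y n) < e" if "m \<ge> M" "n \<ge> M" for m n
    proof -
      have "inverse (real (Suc m)) \<le> inverse (real (Suc M))" "inverse (real (Suc n)) \<le> inverse (real (Suc M))"
        using that by (simp_all add: field_simps)
      with dist[of m n] M show ?thesis by linarith
    qed
    then show "\<exists>M. \<forall>m\<ge>M. \<forall>n\<ge>M. dist (Y m) (Y n) < e" by blast
  qed
  then obtain y where y: "Y \<longlonglongrightarrow> y" by (auto simp: Cauchy_convergent_iff convergent_def)
  have "hadamard_right_limit f x v y"
    unfolding hadamard_right_limit_def
  proof (intro allI impI)
    fix e :: real assume "e > 0"
    then have "\<forall>\<^sub>F n in sequentially. dist (Y n) y < e / 2" using y by (intro tendstoD) auto
    moreover have "\<forall>\<^sub>F n in sequentially. inverse (real (Suc n)) < e / 2"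
      using \<open>e > 0\<close> by (intro order_tendstoD(2)[OF LIMSEQ_inverse_real_of_nat]) simp
    ultimately have "\<forall>\<^sub>F n in sequentially. dist (Y n) y < e / 2 \<and> inverse (real (Suc n)) < e / 2"
      by (rule eventually_conj)
    then obtain n where n: "dist (Y n) y < e / 2" "inverse (real (Suc n)) < e / 2"
      using eventually_happens'[OF sequentially_bot] by blast
    obtain d where d: "d > 0" "\<forall>\<^sub>F t in at_right 0. \<forall>z\<in>ball v d. norm (diff_quot f x t z - Y n) \<le> inverse (Suc n)"
      using Y by blast
    have "\<forall>\<^sub>F t in at_right 0. \<forall>z\<in>ball v d. norm (diff_quot f x t z - y) \<le> e"
      using d(2)
    proof eventually_elim
      case (elim t)
      show ?case
      proof
        fix z assume "z \<in> ball v d"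
        then have "norm (diff_quot f x t z - Y n) \<le> inverse (Suc n)" using elim by blast
        then show "norm (diff_quot f x t z - y) \<le> e"
          using n dist_triangle[of "diff_quot f x t z" y "Y n"] unfolding dist_norm by linarith
      qed
    qed
    with d show "\<exists>d>0. \<forall>\<^sub>F t in at_right 0. \<forall>z\<in>ball v d. norm (diff_quot f x t z - y) \<le> e" by blast
  qed
  then show ?thesis ..
qed

text \<open>Reach \<open>v\<close> as \<open>(v - u) + u\<close> with \<open>u\<close> a nearby
  direction of differentiability. The short leg along \<open>v - u\<close> has small quotient by the
  Lipschitz bound, the other has quotient near the limit along \<open>u\<close>.\<close>

lemma hadamard_steady_limit_closed:
  fixes f :: "'a::real_normed_vector \<Rightarrow> 'b::banach"
  assumes st: "hadamard_steady f x" and v: "v \<in> closure {u. \<exists>y. hadamard_right_limit f x u y}"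
  shows "\<exists>y. hadamard_right_limit f x v y"
proof (rule hadamard_right_limit_cauchy)
  fix e :: real assume "e > 0"
  have "{u. \<exists>y. hadamard_right_limit f x u y} \<noteq> {}" using v by force
  then obtain u0 y0 where y0: "hadamard_right_limit f x u0 y0" by blast
  obtain K where K: "K > 0" and bd: "\<And>R. \<forall>\<^sub>F t in at_right 0. \<forall>z\<in>ball 0 R. norm (diff_quot f x t z) \<le> K * norm z"
    using hadamard_right_limit_0_bound[OF hadamard_steady_limit_0[OF st y0]] by blast
  \<comment> \<open>Below, \<open>norm c\<close> is less than \<open>2 * r\<close>, so the short leg
    contributes at most K * 2 * r = e / 2.\<close>
  define r where "r = e / (4 * K)"
  have r: "r > 0" "K * r = e / 4" using K \<open>e > 0\<close> by (auto simp: r_def)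
  obtain u y where u: "dist u v < r" "hadamard_right_limit f x u y"
    using v r by (auto simp: closure_approachable)
  define e' where "e' = min (e / 2) r"
  have e': "e' > 0" using r \<open>e > 0\<close> by (simp add: e'_def)
  obtain p where p: "p > 0" "p \<le> e'" and *: "\<forall>\<^sub>F t in at_right 0. \<exists>c\<in>ball (v - u) p. \<forall>z\<in>ball (v - u + u) p.
        norm (diff_quot f x t z - diff_quot f x t c - y) \<le> e'"
    using hadamard_steady_translate[OF st u(2) e'] .
  have "\<forall>\<^sub>F t in at_right 0. \<forall>z\<in>ball v p. norm (diff_quot f x t z - y) \<le> e"
    using * bd[of "2 * r"]
  proof eventually_elim
    case (elim t)
    then obtain c where c: "c \<in> ball (v - u) p" and
      cz: "\<And>z. z \<in> ball v p \<Longrightarrow> norm (diff_quot f x t z - diff_quot f x t c - y) \<le> e'" by auto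
    have "norm c < 2 * r" using c u p unfolding mem_ball e'_def by norm
    then have "norm (diff_quot f x t c) \<le> K * norm c" "K * norm c \<le> K * (2 * r)"
      using elim K by (auto intro!: mult_left_mono)
    then have "norm (diff_quot f x t c) \<le> e / 2" using r(2) by simp
    moreover have "e' \<le> e / 2" by (simp add: e'_def)
    ultimately show ?case
    proof (intro ballI)
      fix z assume "norm (diff_quot f x t c) \<le> e / 2" "e' \<le> e / 2" "z \<in> ball v p"
      with cz[OF this(3)] show "norm (diff_quot f x t z - y) \<le> e" by norm
    qed
  qed
  with p show "\<exists>y. \<exists>d>0. \<forall>\<^sub>F t in at_right 0. \<forall>z\<in>ball v d. norm (diff_quot f x t z - y) \<le> e" by blast
qed

section \<open>From right limits to Hadamard differentiability\<close>

lemma subspace_hadamard_steady_limit: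
  assumes "hadamard_steady f x" and "hadamard_right_limit f x 0 0"
  shows "subspace {u. \<exists>y. hadamard_right_limit f x u y}"
proof (rule subspaceI)
  fix u w assume "u \<in> {u. \<exists>y. hadamard_right_limit f x u y}" "w \<in> {u. \<exists>y. hadamard_right_limit f x u y}"
  then show "u + w \<in> {u. \<exists>y. hadamard_right_limit f x u y}"
    using hadamard_steady_limit_add[OF assms(1)] by blast
next
  fix u and c :: real assume "u \<in> {u. \<exists>y. hadamard_right_limit f x u y}"
  then obtain y where y: "hadamard_right_limit f x u y" by blast
  consider "c > 0" | "c = 0" | "- c > 0" by linarith
  then show "c *\<^sub>R u \<in> {u. \<exists>y. hadamard_right_limit f x u y}"
  proof cases
    case 3
    from hadamard_right_limit_scaleR[OF hadamard_steady_limit_minus[OF assms(1) y] this] show ?thesis by auto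
  qed (use hadamard_right_limit_scaleR[OF y] assms(2) in auto)
qed (use assms in auto)

text \<open>The quotient at \<open>- t\<close> along \<open>z\<close> is minus the quotient at
  \<open>t\<close> along \<open>- z\<close>, so linearity of \<open>L\<close> turns the right limits
  along \<open>v\<close> and \<open>- v\<close> into a two-sided one. Local uniformity in the
  direction and continuity of \<open>L\<close> then give uniformity on compact sets by a finite
  cover, and singletons give the pointwise limits.\<close>

lemma hadamard_differentiable_atI:
  assumes L: "bounded_linear L" and lim: "\<And>v. hadamard_right_limit f x v (L v)"
  shows "hadamard_differentiable_at f x"
proof -
  interpret L: bounded_linear L by fact
  have two: "\<exists>d>0. \<forall>\<^sub>F t in at 0. \<forall>z\<in>ball v d. norm (diff_quot f x t z - L v) \<le> e" if e: "e > 0" for v e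
  proof -
    obtain d where d: "d > 0" "\<forall>\<^sub>F t in at_right 0. \<forall>z\<in>ball v d. norm (diff_quot f x t z - L v) \<le> e"
      using hadamard_right_limitD[OF lim e] .
    obtain d' where d': "d' > 0" "\<forall>\<^sub>F t in at_right 0. \<forall>z\<in>ball (- v) d'. norm (diff_quot f x t z - L (- v)) \<le> e"
      using hadamard_right_limitD[OF lim e] .
    have 1: "\<forall>\<^sub>F t in at_right 0. \<forall>z\<in>ball v (min d d'). norm (diff_quot f x t z - L v) \<le> e"
      using d(2) by eventually_elim auto
    have "\<forall>\<^sub>F t in at_right 0. \<forall>z\<in>ball v (min d d'). norm (diff_quot f x (- t) z - L v) \<le> e"
      using d'(2)
    proof eventually_elim
      case (elim t)
      show ?case
      proof
        fix z assume "z \<in> ball v (min d d')"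
        then have "- z \<in> ball (- v) d'" by (simp add: dist_norm norm_minus_commute)
        then have "norm (diff_quot f x t (- z) - L (- v)) \<le> e" using elim by blast
        moreover have "diff_quot f x t (- z) = - diff_quot f x (- t) z"
          by (simp add: diff_quot_def)
        ultimately show "norm (diff_quot f x (- t) z - L v) \<le> e"
          by (simp add: bounded_linear.linear[OF L, THEN linear_neg] norm_minus_commute)
      qed
    qed
    then have "\<forall>\<^sub>F t in at_left 0. \<forall>z\<in>ball v (min d d'). norm (diff_quot f x t z - L v) \<le> e"
      by (subst (asm) at_right_minus) (simp add: eventually_filtermap)
    with 1 have "\<forall>\<^sub>F t in at 0. \<forall>z\<in>ball v (min d d'). norm (diff_quot f x t z - L v) \<le> e"
      by (simp add: eventually_at_split)
    with d d' show ?thesis by (intro exI[of _ "min d d'"]) simp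
  qed
  have "uniform_limit C (diff_quot f x) L (at 0)" if C: "compact C" for C
  proof (rule uniform_limitI)
    fix e :: real assume "e > 0"
    then have e: "e / 3 > 0" by simp
    have "\<exists>d>0. \<forall>\<^sub>F t in at 0. \<forall>z\<in>ball v d. dist (diff_quot f x t z) (L z) < e" for v
    proof -
      obtain d where d: "d > 0" "\<forall>\<^sub>F t in at 0. \<forall>z\<in>ball v d. norm (diff_quot f x t z - L v) \<le> e / 3"
        using two[OF e] by blast
      have "isCont L v" by (rule L.isCont) (rule continuous_ident)
      then obtain d' where d': "d' > 0" "\<And>z. dist z v < d' \<Longrightarrow> dist (L z) (L v) < e / 3"
        using e unfolding continuous_at_eps_delta by blast
      have "\<forall>\<^sub>F t in at 0. \<forall>z\<in>ball v (min d d'). dist (diff_quot f x t z) (L z) < e"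
        using d(2)
      proof eventually_elim
        case (elim t)
        show ?case
        proof
          fix z assume "z \<in> ball v (min d d')"
          then have "z \<in> ball v d" "dist z v < d'" by (simp_all add: dist_commute)
          then have "norm (diff_quot f x t z - L v) \<le> e / 3" "dist (L z) (L v) < e / 3"
            using elim d'(2) by blast+
          then show "dist (diff_quot f x t z) (L z) < e" using e by norm
        qed
      qed
      with d d' show ?thesis by (intro exI[of _ "min d d'"]) simp
    qed
    from choice[OF allI, OF this] obtain d where
      d: "\<forall>v. d v > 0 \<and> (\<forall>\<^sub>F t in at 0. \<forall>z\<in>ball v (d v). dist (diff_quot f x t z) (L z) < e)"
      by (rule exE)
    have "C \<subseteq> (\<Union>v\<in>C. ball v (d v))" using d by auto
    then obtain F where F: "F \<subseteq> C" "finite F" "C \<subseteq> (\<Union>v\<in>F. ball v (d v))"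
      using compactE_image[OF C, of C "\<lambda>v. ball v (d v)"] by auto
    have "\<forall>\<^sub>F t in at 0. \<forall>v\<in>F. \<forall>z\<in>ball v (d v). dist (diff_quot f x t z) (L z) < e"
      using d F(2) by (simp add: eventually_ball_finite)
    then show "\<forall>\<^sub>F t in at 0. \<forall>v\<in>C. dist (diff_quot f x t v) (L v) < e"
      by eventually_elim (use F(3) in blast)
  qed
  moreover from this have "(\<lambda>t. diff_quot f x t v) \<midarrow>0\<rightarrow> L v" for v
    by (metis compact_sing singletonI tendsto_uniform_limitI)
  ultimately show ?thesis
    unfolding hadamard_differentiable_at_def diff_quot_def using L by blast
qed

text \<open>The directions with a limit form a closed subspace containing \<open>S\<close>, hence
  the whole space. Uniqueness of limits turns the algebraic rules into linearity of
  \<open>L\<close>, and the Lipschitz bound makes \<open>L\<close> bounded.\<close>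

lemma hadamard_steady_imp_differentiable:
  fixes f :: "'a::real_normed_vector \<Rightarrow> 'b::banach"
  assumes st: "hadamard_steady f x" and S: "closure (span S) = UNIV"
    and ex: "\<And>u. u \<in> S \<Longrightarrow> \<exists>y. hadamard_right_limit f x u y"
  shows "hadamard_differentiable_at f x"
proof -
  let ?H = "{u. \<exists>y. hadamard_right_limit f x u y}"
  have lim0: "hadamard_right_limit f x 0 0"
  \<comment> \<open>With \<open>S\<close> empty there is no direction to start from, but its span is
    the zero subspace, so density forces the space to be trivial.\<close>
  proof (cases "S = {}")
    case True
    then have "\<And>z::'a. z = 0" using S by auto
    then have "diff_quot f x t z = 0" for t z by (metis diff_quot_0)
    then show ?thesis by (auto simp: hadamard_right_limit_def intro: exI[of _ 1])
  next
    case False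
    then show ?thesis using ex hadamard_steady_limit_0[OF st] by blast
  qed
  have "span S \<subseteq> ?H"
    using ex by (intro span_minimal subspace_hadamard_steady_limit st lim0) auto
  then have "closure ?H = UNIV" using S closure_mono by blast
  then have "\<exists>y. hadamard_right_limit f x v y" for v
    using hadamard_steady_limit_closed[OF st, of v] by simp
  then obtain L where L: "\<And>v. hadamard_right_limit f x v (L v)" by metis
  note unique = hadamard_right_limit_unique[OF L]
  obtain K where K: "\<And>R. \<forall>\<^sub>F t in at_right 0. \<forall>z\<in>ball 0 R. norm (diff_quot f x t z) \<le> K * norm z"
    using hadamard_right_limit_0_bound[OF lim0] by blast
  have "bounded_linear L"
  proof (rule bounded_linear_intro)
    show "L (u + w) = L u + L w" for u w
      by (intro unique hadamard_steady_limit_add st L)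
    have minus: "L (- u) = - L u" for u
      by (intro unique hadamard_steady_limit_minus st L)
    have pos: "L (c *\<^sub>R u) = c *\<^sub>R L u" if "c > 0" for c u
      by (intro unique hadamard_right_limit_scaleR that L)
    show "L (c *\<^sub>R u) = c *\<^sub>R L u" for c u
    proof -
      consider "c > 0" | "c = 0" | "- c > 0" by linarith
      then show ?thesis
      proof cases
        case 3
        then show ?thesis using pos[OF 3, of u] minus[of "c *\<^sub>R u"] by simp
      qed (use pos unique[OF lim0] in auto)
    qed
    show "norm (L v) \<le> norm v * K" for v
    proof (rule field_le_epsilon)
      fix e :: real assume "e > 0"
      obtain d where d: "d > 0" "\<forall>\<^sub>F t in at_right 0. \<forall>z\<in>ball v d. norm (diff_quot f x t z - L v) \<le> e"
        using hadamard_right_limitD[OF L \<open>e > 0\<close>] .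
      have "\<forall>\<^sub>F t in at_right (0::real). norm (L v) \<le> norm v * K + e"
        using d(2) K[of "norm v + 1"]
      proof eventually_elim
        case (elim t)
        then have "norm (diff_quot f x t v - L v) \<le> e" "norm (diff_quot f x t v) \<le> norm v * K"
          using d by (auto simp: mult.commute)
        then show ?case
          using norm_triangle_ineq2[of "L v" "diff_quot f x t v"]
          by (simp add: norm_minus_commute)
      qed
      then show "norm (L v) \<le> norm v * K + e" by simp
    qed
  qed
  then show ?thesis using L by (rule hadamard_differentiable_atI)
qed

section \<open>The exceptional set\<close>

theorem corollary3p9:
  fixes G :: "'a::banach set" and f :: "'a \<Rightarrow> 'b::banach"
  assumes "separable_space (euclidean :: 'a topology)"
    and "open G"
  shows "\<exists>A. A \<subseteq> G \<and> sigma_directionally_porous A \<and>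
    (\<forall>x \<in> G - A.
      (\<exists>S. closure (span S) = UNIV \<and> (\<forall>u\<in>S. hadamard_right_derivative_exists f x u))
        \<longrightarrow> hadamard_differentiable_at f x)"
proof -
  obtain D :: "'a set" where D: "countable D" "closure D = UNIV"
    using assms(1) unfolding separable_space_def by auto
  \<comment> \<open>Porosity is tested against the whole approximation set, so that points outside
    satisfy the premise of \<open>hadamard_steadyI\<close>. It passes to the subset collected here
    by monotonicity.\<close>
  define P where "P = (\<lambda>(u, m, n). {x \<in> G \<inter> approx_set f u m n. directionally_porous_at (approx_set f u m n) x})"
  define \<C> where "\<C> = P ` (D \<times> UNIV)"
  have "directionally_porous (P i)" for i
    unfolding directionally_porous_def P_def
    by (auto split: prod.splits elim: directionally_porous_at_mono)
  moreover have "countable \<C>"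
    unfolding \<C>_def using D by (intro countable_image countable_SIGMA) auto
  ultimately have "sigma_directionally_porous (\<Union>\<C>)"
    unfolding sigma_directionally_porous_def \<C>_def by blast
  moreover have "\<Union>\<C> \<subseteq> G" by (auto simp: \<C>_def P_def)
  moreover have "hadamard_differentiable_at f x"
    if x: "x \<in> G - \<Union>\<C>" and S: "closure (span S) = UNIV" "\<forall>u\<in>S. hadamard_right_derivative_exists f x u" for x S
  proof -
    have "\<not> directionally_porous_at (approx_set f u m n) x"
      if "u \<in> D" "x \<in> approx_set f u m n" for u m n
      using that x unfolding \<C>_def P_def by auto
    then have "hadamard_steady f x" by (rule hadamard_steadyI[OF D(2)])
    then show ?thesis
      using S(1)
      by (rule hadamard_steady_imp_differentiable)
        (use S(2) hadamard_right_derivative_exists_imp_limit in blast)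
  qed
  ultimately show ?thesis by blast
qed

end
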